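(* Let $1<q<p<\infty$ and let $\lambda,\alpha,\beta,\varphi,\psi$ be real numbers. If $\varphi+1<p(\alpha+1)$, then the operator $\mathbf{H}_{\lambda,\alpha,\beta}$ is bounded from $l_{\varphi}^p$ to $L_{\psi}^q$ if and only if both $$\lambda>\alpha+\beta+1+\frac{\psi+1}{q}-\frac{\varphi+1}{p}\qquad\text{and}\qquad -q\beta<\psi+1$$ hold.
   Context: Let $\mathbb{R}_{+}=(0,+\infty)$ and $\mathbb{N}=\{1,2,3,\dots\}$. For real $\lambda,\alpha,\beta$ and a real sequence $a=\{a_m\}_{m=1}^{\infty}$, define $$\mathbf{H}_{\lambda,\alpha,\beta}a(x):=\sum_{m=1}^{\infty}\frac{m^{\alpha}x^{\beta}}{[\max\{m,x\}]^{\lambda}}a_m,\quad x\in\mathbb{R}_{+}.$$ For $1\le p<\infty$ and $\theta\in\mathbb{R}$, $l_\theta^p$ is the space of real sequences with $\|a\|_{p,\theta}=(\sum_{n=1}^\infty n^\theta|a_n|^p)^{1/p}<\infty$, and $L_\theta^p$ is the space of real-valued measurable functions $f$ on $\mathbb{R}_{+}$ with $\|f\|_{p,\theta}=(\int_{\mathbb{R}_{+}}|f(x)|^p x^\theta\,dx)^{1/p}<\infty$. The operator is bounded from a sequence space $X$ to a function space $Y$ if for every $a\in X$ the defining series converges for a.e. $x\in\mathbb{R}_{+}$ and there is a constant $C$ with $\|\mathbf{H}_{\lambda,\alpha,\beta}a\|_Y\le C\|a\|_X$ for all $a\in X$. *)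

theory Defs
  imports "HOL-Analysis.Analysis"
begin

text \<open>
  Real sequences indexed by $1, 2, 3, \dots$ are functions of type \<open>nat \<Rightarrow> real\<close> whose value
  at \<open>0\<close> is never used: the term of index $m \geq 1$ is \<open>a (Suc k)\<close> with $m = k + 1$.
  All real powers have nonnegative base and are written with \<open>powr\<close>, for which
  \<open>0 powr r = 0\<close>; in \<open>\<bar>t\<bar> powr p\<close> the exponent is positive throughout.
\<close>

definition seq_space :: "real \<Rightarrow> real \<Rightarrow> (nat \<Rightarrow> real) set" where
  "seq_space p \<theta> = {a. summable (\<lambda>k. real (Suc k) powr \<theta> * \<bar>a (Suc k)\<bar> powr p)}"

definition seq_norm :: "real \<Rightarrow> real \<Rightarrow> (nat \<Rightarrow> real) \<Rightarrow> real" where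
  "seq_norm p \<theta> a = (\<Sum>k. real (Suc k) powr \<theta> * \<bar>a (Suc k)\<bar> powr p) powr (1 / p)"

text \<open>For a measurable \<open>f\<close> the integrand below is nonnegative and measurable, so that
  integrability means that its integral is finite.\<close>

definition fun_space :: "real \<Rightarrow> real \<Rightarrow> (real \<Rightarrow> real) set" where
  "fun_space p \<theta> = {f. f \<in> borel_measurable (lebesgue_on {0<..}) \<and>
     integrable (lebesgue_on {0<..}) (\<lambda>x. \<bar>f x\<bar> powr p * x powr \<theta>)}"

definition fun_norm :: "real \<Rightarrow> real \<Rightarrow> (real \<Rightarrow> real) \<Rightarrow> real" where
  "fun_norm p \<theta> f =
     (integral\<^sup>L (lebesgue_on {0<..}) (\<lambda>x. \<bar>f x\<bar> powr p * x powr \<theta>)) powr (1 / p)"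

definition H_term :: "real \<Rightarrow> real \<Rightarrow> real \<Rightarrow> (nat \<Rightarrow> real) \<Rightarrow> real \<Rightarrow> nat \<Rightarrow> real" where
  "H_term lam \<alpha> \<beta> a x m = real m powr \<alpha> * x powr \<beta> / (max (real m) x) powr lam * a m"

definition H_op :: "real \<Rightarrow> real \<Rightarrow> real \<Rightarrow> (nat \<Rightarrow> real) \<Rightarrow> real \<Rightarrow> real" where
  "H_op lam \<alpha> \<beta> a x = (\<Sum>k. H_term lam \<alpha> \<beta> a x (Suc k))"

text \<open>The operator given by the kernel with parameters \<open>lam, \<alpha>, \<beta>\<close> is bounded from the weighted
  sequence space with exponent \<open>p\<close> and weight \<open>\<phi>\<close> to the weighted function space with exponent
  \<open>q\<close> and weight \<open>\<psi>\<close>. Membership of the image is explicit because \<open>fun_norm\<close> is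
  real-valued and says nothing about functions outside the space.\<close>

definition H_bounded ::
    "real \<Rightarrow> real \<Rightarrow> real \<Rightarrow> real \<Rightarrow> real \<Rightarrow> real \<Rightarrow> real \<Rightarrow> bool" where
  "H_bounded lam \<alpha> \<beta> p \<phi> q \<psi> \<longleftrightarrow>
     (\<forall>a \<in> seq_space p \<phi>.
        AE x in lebesgue_on {0<..}. summable (\<lambda>k. H_term lam \<alpha> \<beta> a x (Suc k))) \<and>
     (\<exists>C. \<forall>a \<in> seq_space p \<phi>.
        H_op lam \<alpha> \<beta> a \<in> fun_space q \<psi> \<and>
        fun_norm q \<psi> (H_op lam \<alpha> \<beta> a) \<le> C * seq_norm p \<phi> a)"

end

theory Submission
  imports Defs
begin

text \<open>
  Write $A = \alpha + 1 - (\varphi+1)/p$ and $B = \beta + (\psi+1)/q$. The hypothesis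
  $\varphi + 1 < p(\alpha+1)$ says $A > 0$, and the two conditions of the theorem say
  $\lambda > A + B$ and $B > 0$.

  Sufficiency. Because $\lambda > A + B$ is strict and $A, B > 0$, there is an $s$ with
  $A < s < \lambda - B$, and then $0 \leq s \leq \lambda$. For $m \geq 1$ this allows the kernel
  to be separated,
  $$\max(m,x)^{-\lambda} \leq m^{-s} \max(1,x)^{s-\lambda}$$
  (\<open>kernel_bound\<close>). After the separation the variable $m$ is disposed of by Hoelder's inequality:
  $m^{\alpha - s - \varphi/p}$ is in $l^{p'}$, $p' = p/(p-1)$, exactly because $s > A$. So
  $|\mathbf{H}a(x)| \leq K \|a\|_{p,\varphi}\, x^\beta \max(1,x)^{s-\lambda}$
  (\<open>H_pointwise_bound\<close>), and the function on the right is in $L^q_\psi$: near $0$ because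
  $B > 0$, near infinity because $s < \lambda - B$.

  Necessity. The sequence $(1,0,0,\dots)$ is mapped to a function that equals $x^\beta$ on
  $(0,1]$, which forces $B > 0$ (\<open>H_bounded_imp_weight_condition\<close>). For the other condition the
  extremal power $m^{-(\varphi+1)/p}$, cut off after $N$ terms, has norm
  $(1 + 1/2 + \dots + 1/N)^{1/p}$, of order $(\ln N)^{1/p}$. For $1 \leq x \leq N$ the terms with
  $x/2 \leq m \leq x$ already show that its image is at least a constant times
  $x^{A+\beta-\lambda}$. If $\lambda \leq A + B$, the $q$-th power of this times $x^\psi$ is at
  least a constant times $1/x$, so the norm of the image is at least of order
  $(\ln N)^{1/q}$. As $q < p$, no constant can bound this by $(\ln N)^{1/p}$ for all $N$
  (\<open>H_bounded_imp_exponent_condition\<close>).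
\<close>

section \<open>Series and integrals\<close>

text \<open>
  As in the integral version, both sequences are normalised to norm 1 and Young's inequality is
  summed term by term; if one norm vanishes, so do all the products.
\<close>

lemma Holder_series:
  fixes u v :: "nat \<Rightarrow> real"
  assumes "1 < p" "1 < q" "1 / p + 1 / q = 1"
    and u: "summable (\<lambda>k. \<bar>u k\<bar> powr p)" and v: "summable (\<lambda>k. \<bar>v k\<bar> powr q)"
  shows "summable (\<lambda>k. \<bar>u k * v k\<bar>)"
    and "(\<Sum>k. \<bar>u k * v k\<bar>)
      \<le> (\<Sum>k. \<bar>u k\<bar> powr p) powr (1 / p) * (\<Sum>k. \<bar>v k\<bar> powr q) powr (1 / q)"
proof -
  have young: "\<bar>s * t\<bar> \<le> \<bar>s\<bar> powr p / p + \<bar>t\<bar> powr q / q" for s t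
    using Youngs_inequality[OF assms(1-3), of "\<bar>s\<bar>" "\<bar>t\<bar>"] by (simp add: abs_mult)
  show *: "summable (\<lambda>k. \<bar>u k * v k\<bar>)"
    by (rule summable_comparison_test'[where N = 0, OF summable_add[OF
          summable_divide[OF u, of p] summable_divide[OF v, of q]]])
       (use young in auto)
  define U where "U = (\<Sum>k. \<bar>u k\<bar> powr p)"
  define V where "V = (\<Sum>k. \<bar>v k\<bar> powr q)"
  have nonneg: "0 \<le> U" "0 \<le> V"
    unfolding U_def V_def by (auto intro!: suminf_nonneg u v)
  show "(\<Sum>k. \<bar>u k * v k\<bar>) \<le> U powr (1 / p) * V powr (1 / q)"
  proof (cases "U = 0 \<or> V = 0")
    case True
    then have "u k = 0 \<or> v k = 0" for k
      using suminf_eq_zero_iff[OF u] suminf_eq_zero_iff[OF v]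
      by (auto simp: U_def V_def)
    then have "(\<lambda>k. \<bar>u k * v k\<bar>) = (\<lambda>k. 0)"
      by auto
    then have "(\<Sum>k. \<bar>u k * v k\<bar>) = 0"
      by simp
    then show ?thesis
      by simp
  next
    case False
    define c where "c = U powr (1 / p) * V powr (1 / q)"
    have pos: "0 < U" "0 < V" "0 < c"
      using False nonneg by (auto simp: c_def)
    have le: "\<bar>u k * v k\<bar> \<le> c * (\<bar>u k\<bar> powr p / U / p + \<bar>v k\<bar> powr q / V / q)" for k
    proof -
      have "\<bar>u k * v k\<bar> / c = \<bar>u k / U powr (1 / p) * (v k / V powr (1 / q))\<bar>"
        using pos by (simp add: c_def abs_mult)
      also have "\<dots> \<le> \<bar>u k\<bar> powr p / U / p + \<bar>v k\<bar> powr q / V / q"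
        using young[of "u k / U powr (1 / p)" "v k / V powr (1 / q)"] pos assms
        by (simp add: powr_divide powr_powr)
      finally show ?thesis
        using pos by (simp add: field_simps)
    qed
    have sums: "(\<lambda>k. c * (\<bar>u k\<bar> powr p / U / p + \<bar>v k\<bar> powr q / V / q))
        sums (c * (U / U / p + V / V / q))"
      unfolding U_def V_def
      by (intro sums_mult sums_add sums_divide summable_sums u v)
    have "(\<Sum>k. \<bar>u k * v k\<bar>) \<le> c * (U / U / p + V / V / q)"
      using sums_le[OF le summable_sums[OF *] sums] .
    also have "\<dots> = c"
      using pos assms by simp
    finally show ?thesis
      by (simp add: c_def)
  qed
qed

lemma integrable_powr_mult_max_powr:
  fixes c d :: real
  assumes "- 1 < c" "c + d < - 1"
  shows "integrable (lebesgue_on {0<..}) (\<lambda>x. x powr c * max 1 x powr d)"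
proof -
  let ?f = "\<lambda>x. x powr c * max 1 x powr d"
  have "(\<lambda>x. x powr c) integrable_on {0..1}"
    using assms by (intro integrable_on_powr_from_0) auto
  then have "?f integrable_on {0..1}"
    by (rule integrable_eq) auto
  then have 1: "?f absolutely_integrable_on {0..1}"
    by (rule nonnegative_absolutely_integrable_1) auto
  have "(\<lambda>x. x powr (c + d)) integrable_on {1..}"
    using has_integral_powr_to_inf[of "c + d" 1] assms by (auto simp: integrable_on_def)
  then have "?f integrable_on {1..}"
    by (rule integrable_eq) (auto simp: powr_add max_def)
  then have 2: "?f absolutely_integrable_on {1..}"
    by (rule nonnegative_absolutely_integrable_1) auto
  have "?f absolutely_integrable_on ({0..1} \<union> {1..})"
    using 1 2 by (intro absolutely_integrable_Un)
  then have "?f absolutely_integrable_on {0<..}"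
    by (rule set_integrable_subset) auto
  then show ?thesis
    by (simp add: set_integrable_def integrable_restrict_space)
qed

text \<open>
  Both necessary conditions come from comparing an integrand with $c/x$ on a long interval, near
  $0$ in one case and near infinity in the other.
\<close>

lemma ln_le_integral:
  fixes f :: "real \<Rightarrow> real"
  assumes f: "integrable (lebesgue_on {0<..}) f" and nonneg: "\<And>x. 0 < x \<Longrightarrow> 0 \<le> f x"
    and ab: "0 < a" "a \<le> b" and le: "\<And>x. x \<in> {a..b} \<Longrightarrow> c / x \<le> f x"
  shows "c * ln (b / a) \<le> integral\<^sup>L (lebesgue_on {0<..}) f"
proof -
  have "((\<lambda>x. c / x) has_integral (c * ln b - c * ln a)) {a..b}"
    using ab by (intro fundamental_theorem_of_calculus)
      (auto intro!: derivative_eq_intros simp flip: has_real_derivative_iff_has_vector_derivative)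
  then have "((\<lambda>x. if x \<in> {a..b} then c / x else 0) has_integral (c * ln b - c * ln a)) {0<..}"
    using ab by (subst has_integral_restrict) auto
  moreover have "(f has_integral integral\<^sup>L (lebesgue_on {0<..}) f) {0<..}"
    using f by (intro has_integral_integral_lebesgue_on) auto
  ultimately have "c * ln b - c * ln a \<le> integral\<^sup>L (lebesgue_on {0<..}) f"
    by (rule has_integral_le) (use le nonneg in auto)
  then show ?thesis
    using ab by (simp add: ln_div algebra_simps)
qed

text \<open>
  The order of magnitude comes from the terms with $x/2 \leq m \leq x$ alone: there are at
  least $x/4$ of them, and on this range $(m/x)^r \geq 2^{-|r|}$ whatever the sign of $r$.
\<close>

lemma sum_powr_lower_bound:
  fixes x r :: real
  assumes "1 \<le> x"
  shows "(1 / 2) powr \<bar>r\<bar> / 4 * x powr (r + 1) \<le> (\<Sum>m = 1..nat \<lfloor>x\<rfloor>. real m powr r)"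
proof -
  define n where "n = nat \<lfloor>x\<rfloor>"
  have n: "1 \<le> n" "real n \<le> x" "x < real n + 1"
    using assms by (auto simp: n_def le_nat_iff)
  have term_le: "(1 / 2) powr \<bar>r\<bar> * x powr r \<le> real m powr r" if "m \<in> {n div 2 + 1..n}" for m
  proof -
    have "n + 1 \<le> 2 * m" "m \<le> n"
      using that by auto
    then have "real n + 1 \<le> 2 * real m" "real m \<le> real n"
      by linarith+
    then have "x \<le> 2 * real m" "real m \<le> x"
      using n by linarith+
    then have ratio: "1 / 2 \<le> real m / x" "real m / x \<le> 1"
      using assms by (simp_all add: field_simps)
    have "(1 / 2) powr \<bar>r\<bar> \<le> (real m / x) powr r"
    proof (cases "0 \<le> r")
      case True
      then show ?thesis
        using ratio by (simp add: powr_mono2)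
    next
      case False
      have "(1 / 2) powr \<bar>r\<bar> \<le> (1::real) powr r"
        using powr_mono'[of 0 "\<bar>r\<bar>" "1/2"] by simp
      also have "\<dots> \<le> (real m / x) powr r"
        using False ratio by (intro powr_mono2') linarith+
      finally show ?thesis .
    qed
    then show ?thesis
      using assms by (simp add: powr_divide field_simps)
  qed
  have "n \<le> 2 * card {n div 2 + 1..n}"
    by auto
  then have "real n \<le> 2 * real (card {n div 2 + 1..n})"
    by linarith
  then have card: "x / 4 \<le> real (card {n div 2 + 1..n})"
    using n by linarith
  have "(1 / 2) powr \<bar>r\<bar> / 4 * x powr (r + 1) = x / 4 * ((1 / 2) powr \<bar>r\<bar> * x powr r)"
    using assms by (simp add: powr_add)
  also have "\<dots> \<le> real (card {n div 2 + 1..n}) * ((1 / 2) powr \<bar>r\<bar> * x powr r)"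
    using card by (intro mult_right_mono) auto
  also have "\<dots> \<le> (\<Sum>m = n div 2 + 1..n. real m powr r)"
    using sum_bounded_below[of "{n div 2 + 1..n}" "(1 / 2) powr \<bar>r\<bar> * x powr r"] term_le by auto
  also have "\<dots> \<le> (\<Sum>m = 1..n. real m powr r)"
    by (intro sum_mono2) auto
  finally show ?thesis
    by (simp add: n_def)
qed

section \<open>The separated kernel and the pointwise bound\<close>

text \<open>
  The factor $\max(m,x)^{-\lambda}$ is split as $\max(m,x)^{-s} \max(m,x)^{s-\lambda}$. Both
  exponents are nonpositive, so the maximum may be replaced by $m$ in the first factor and by
  $\max(1,x)$ in the second.
\<close>

lemma kernel_bound:
  fixes m x :: real
  assumes "1 \<le> m" "0 \<le> s" "s \<le> lam"
  shows "1 / max m x powr lam \<le> m powr (- s) * max 1 x powr (s - lam)"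
proof -
  have "1 / max m x powr lam = max m x powr (- s) * max m x powr (s - lam)"
    using assms by (simp add: powr_minus_divide powr_diff)
  also have "\<dots> \<le> m powr (- s) * max 1 x powr (s - lam)"
    using assms by (intro mult_mono powr_mono2') auto
  finally show ?thesis .
qed

lemma borel_measurable_H_op:
  "H_op lam \<alpha> \<beta> a \<in> borel_measurable (lebesgue_on {0<..})"
proof -
  have "H_op lam \<alpha> \<beta> a \<in> borel_measurable borel"
    unfolding H_op_def[abs_def] H_term_def by measurable
  then show ?thesis
    by (intro measurable_restrict_space1 measurable_completion) simp
qed

text \<open>
  Hoelder's inequality is applied to $u_m = m^{\varphi/p} a_m$, whose $l^p$ norm is
  $\|a\|_{p,\varphi}$, and $v_m = m^{\alpha - \varphi/p - s}$. The lower bound on $s$ is what puts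
  $v$ into $l^{p'}$. The constant $K$ depends neither on $a$ nor on $x$.
\<close>

lemma H_pointwise_bound:
  fixes p lam \<alpha> \<beta> \<phi> s x :: real
  assumes p: "1 < p" and a: "a \<in> seq_space p \<phi>"
    and s: "\<alpha> + 1 - (\<phi> + 1) / p < s" "0 \<le> s" "s \<le> lam"
  defines "K \<equiv> (\<Sum>k. real (Suc k) powr ((\<alpha> - \<phi> / p - s) * (p / (p - 1)))) powr (1 - 1 / p)"
  shows "summable (\<lambda>k. H_term lam \<alpha> \<beta> a x (Suc k))"
    and "\<bar>H_op lam \<alpha> \<beta> a x\<bar> \<le> K * seq_norm p \<phi> a * (x powr \<beta> * max 1 x powr (s - lam))"
proof -
  define u where "u k = real (Suc k) powr (\<phi> / p) * a (Suc k)" for k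
  define v where "v k = real (Suc k) powr (\<alpha> - \<phi> / p - s)" for k
  define G where "G = x powr \<beta> * max 1 x powr (s - lam)"
  have u_powr: "\<bar>u k\<bar> powr p = real (Suc k) powr \<phi> * \<bar>a (Suc k)\<bar> powr p" for k
    using p by (simp add: u_def abs_mult powr_mult powr_powr)
  have v_powr: "\<bar>v k\<bar> powr (p / (p - 1)) = real (Suc k) powr ((\<alpha> - \<phi> / p - s) * (p / (p - 1)))" for k
    by (simp add: v_def powr_powr)
  have exponent: "(\<alpha> - \<phi> / p - s) * (p / (p - 1)) < - 1"
  proof -
    have "\<alpha> - \<phi> / p - s < - ((p - 1) / p)"
      using p s by (simp add: diff_divide_distrib add_divide_distrib)
    then have "(\<alpha> - \<phi> / p - s) * (p / (p - 1)) < - ((p - 1) / p) * (p / (p - 1))"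
      using p by (intro mult_strict_right_mono) auto
    also have "\<dots> = - 1"
      using p by (simp add: field_simps)
    finally show ?thesis .
  qed
  have "summable (\<lambda>k. real (Suc k) powr ((\<alpha> - \<phi> / p - s) * (p / (p - 1))))"
    using exponent by (subst summable_Suc_iff, subst summable_real_powr_iff)
  then have v: "summable (\<lambda>k. \<bar>v k\<bar> powr (p / (p - 1)))"
    unfolding v_powr .
  have u: "summable (\<lambda>k. \<bar>u k\<bar> powr p)"
    using a by (simp add: u_powr seq_space_def)
  have conj: "1 < p / (p - 1)" "1 / p + 1 / (p / (p - 1)) = 1" "1 / (p / (p - 1)) = 1 - 1 / p"
    using p by (simp_all add: field_simps)
  note Holder = Holder_series[OF p conj(1,2) u v]
  have term_le: "\<bar>H_term lam \<alpha> \<beta> a x (Suc k)\<bar> \<le> G * \<bar>u k * v k\<bar>" for k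
  proof -
    let ?m = "real (Suc k)"
    have "\<bar>H_term lam \<alpha> \<beta> a x (Suc k)\<bar>
        = ?m powr \<alpha> * x powr \<beta> * \<bar>a (Suc k)\<bar> * (1 / max ?m x powr lam)"
      by (simp add: H_term_def abs_mult)
    also have "\<dots> \<le> ?m powr \<alpha> * x powr \<beta> * \<bar>a (Suc k)\<bar> * (?m powr (- s) * max 1 x powr (s - lam))"
      using s by (intro mult_left_mono kernel_bound) auto
    also have "\<dots> = G * (?m powr (\<alpha> + - s) * \<bar>a (Suc k)\<bar>)"
      unfolding powr_add G_def by (simp only: mult_ac)
    also have "\<alpha> + - s = \<phi> / p + (\<alpha> - \<phi> / p - s)"
      by simp
    also have "?m powr \<dots> * \<bar>a (Suc k)\<bar> = \<bar>u k * v k\<bar>"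
      unfolding powr_add by (simp add: u_def v_def abs_mult)
    finally show ?thesis .
  qed
  have G_nonneg: "0 \<le> G"
    by (simp add: G_def)
  have abs_summable: "summable (\<lambda>k. \<bar>H_term lam \<alpha> \<beta> a x (Suc k)\<bar>)"
    by (rule summable_comparison_test'[where N = 0, OF summable_mult[OF Holder(1), of G]])
       (use term_le in auto)
  then show "summable (\<lambda>k. H_term lam \<alpha> \<beta> a x (Suc k))"
    by (rule summable_rabs_cancel)
  have "\<bar>H_op lam \<alpha> \<beta> a x\<bar> \<le> (\<Sum>k. \<bar>H_term lam \<alpha> \<beta> a x (Suc k)\<bar>)"
    unfolding H_op_def by (rule summable_rabs[OF abs_summable])
  also have "\<dots> \<le> (\<Sum>k. G * \<bar>u k * v k\<bar>)"
    by (intro suminf_le term_le abs_summable summable_mult Holder(1))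
  also have "\<dots> = G * (\<Sum>k. \<bar>u k * v k\<bar>)"
    by (rule suminf_mult[OF Holder(1)])
  also have "\<dots> \<le> G * (seq_norm p \<phi> a * K)"
    using Holder(2) G_nonneg unfolding u_powr v_powr conj(3) K_def seq_norm_def
    by (rule mult_left_mono)
  finally show "\<bar>H_op lam \<alpha> \<beta> a x\<bar> \<le> K * seq_norm p \<phi> a * (x powr \<beta> * max 1 x powr (s - lam))"
    by (simp add: G_def mult_ac)
qed

section \<open>Sufficiency of the two conditions\<close>

lemma H_boundedI:
  fixes p q lam \<alpha> \<beta> \<phi> \<psi> :: real
  assumes p: "1 < p" and q: "0 < q" and "\<phi> + 1 < p * (\<alpha> + 1)"
    and lam: "\<alpha> + \<beta> + 1 + (\<psi> + 1) / q - (\<phi> + 1) / p < lam" and \<psi>: "- q * \<beta> < \<psi> + 1"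
  shows "H_bounded lam \<alpha> \<beta> p \<phi> q \<psi>"
proof -
  have pos: "0 < \<alpha> + 1 - (\<phi> + 1) / p" "0 < \<beta> + (\<psi> + 1) / q"
    using assms by (simp_all add: field_simps)
  obtain s where s: "\<alpha> + 1 - (\<phi> + 1) / p < s" "s < lam - (\<beta> + (\<psi> + 1) / q)"
    using dense[of "\<alpha> + 1 - (\<phi> + 1) / p" "lam - (\<beta> + (\<psi> + 1) / q)"] lam
    by (auto simp: algebra_simps)
  then have s': "0 \<le> s" "s \<le> lam"
    using pos by linarith+
  (* the l^(p') norm of m^(\<alpha> - \<phi>/p - s), as in the pointwise bound *)
  define K where "K = (\<Sum>k. real (Suc k) powr ((\<alpha> - \<phi> / p - s) * (p / (p - 1)))) powr (1 - 1 / p)"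
  have K: "0 \<le> K"
    by (simp add: K_def)
  define G where "G x = x powr \<beta> * max 1 x powr (s - lam)" for x
  note bound = H_pointwise_bound[OF p _ s(1) s', where \<beta> = \<beta>, folded K_def G_def]
  have G_eq: "G x powr q * x powr \<psi> = x powr (\<beta> * q + \<psi>) * max 1 x powr ((s - lam) * q)" for x
    by (simp add: G_def powr_mult powr_powr powr_add)
  have "q * s < q * (lam - (\<beta> + (\<psi> + 1) / q))"
    using s(2) q by simp
  also have "\<dots> = q * lam - q * \<beta> - (\<psi> + 1)"
    using q by (simp add: field_simps)
  finally have "q * s + q * \<beta> + \<psi> + 1 < q * lam"
    by simp
  then have G_int: "integrable (lebesgue_on {0<..}) (\<lambda>x. G x powr q * x powr \<psi>)"
    unfolding G_eq using \<psi> q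
    by (intro integrable_powr_mult_max_powr) (auto simp: algebra_simps)
  define C where "C = (integral\<^sup>L (lebesgue_on {0<..}) (\<lambda>x. G x powr q * x powr \<psi>)) powr (1 / q)"
  have "H_op lam \<alpha> \<beta> a \<in> fun_space q \<psi> \<and> fun_norm q \<psi> (H_op lam \<alpha> \<beta> a) \<le> K * C * seq_norm p \<phi> a"
    if a: "a \<in> seq_space p \<phi>" for a
  proof -
    define S where "S = seq_norm p \<phi> a"
    have S: "0 \<le> S"
      by (simp add: S_def seq_norm_def)
    let ?f = "\<lambda>x. \<bar>H_op lam \<alpha> \<beta> a x\<bar> powr q * x powr \<psi>"
    have le: "?f x \<le> (K * S) powr q * (G x powr q * x powr \<psi>)" for x
    proof -
      have "\<bar>H_op lam \<alpha> \<beta> a x\<bar> powr q \<le> (K * S * G x) powr q"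
        using bound(2)[OF a, where x = x] q by (intro powr_mono2) (auto simp: S_def)
      then have "?f x \<le> (K * S * G x) powr q * x powr \<psi>"
        by (rule mult_right_mono) simp
      also have "\<dots> = (K * S) powr q * (G x powr q * x powr \<psi>)"
        using K S by (simp add: powr_mult G_def mult_ac)
      finally show ?thesis .
    qed
    have meas: "H_op lam \<alpha> \<beta> a \<in> borel_measurable (lebesgue_on {0<..})"
      by (rule borel_measurable_H_op)
    have "(\<lambda>x. x powr \<psi>) \<in> borel_measurable (lebesgue_on {0<..})"
      by (intro measurable_restrict_space1 measurable_completion) simp
    with meas have meas_f: "?f \<in> borel_measurable (lebesgue_on {0<..})"
      by measurable
    have int: "integrable (lebesgue_on {0<..}) ?f"
      by (rule Bochner_Integration.integrable_bound[OF integrable_mult_right[where c = "(K * S) powr q", OF G_int] meas_f])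
         (use le in \<open>auto intro!: AE_I2\<close>)
    have "integral\<^sup>L (lebesgue_on {0<..}) ?f
        \<le> (K * S) powr q * integral\<^sup>L (lebesgue_on {0<..}) (\<lambda>x. G x powr q * x powr \<psi>)"
      using integral_mono[OF int integrable_mult_right[where c = "(K * S) powr q", OF G_int]] le by simp
    then have "fun_norm q \<psi> (H_op lam \<alpha> \<beta> a) \<le>
        ((K * S) powr q * integral\<^sup>L (lebesgue_on {0<..}) (\<lambda>x. G x powr q * x powr \<psi>)) powr (1 / q)"
      unfolding fun_norm_def using q by (intro powr_mono2) auto
    also have "\<dots> = K * C * S"
      using K S q by (simp add: powr_mult powr_powr C_def)
    finally show ?thesis
      using meas int by (simp add: fun_space_def S_def)
  qed
  then show ?thesis
    unfolding H_bounded_def using bound(1) by (auto intro!: AE_I2)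
qed

section \<open>Truncated powers as test sequences\<close>

definition truncated_power :: "real \<Rightarrow> nat \<Rightarrow> nat \<Rightarrow> real" where
  "truncated_power c N m = (if m \<le> N then real m powr c else 0)"

lemma truncated_power_in_seq_space: "truncated_power c N \<in> seq_space p \<phi>"
  unfolding seq_space_def
  by (auto intro!: summable_finite[of "{..<N}"] simp: truncated_power_def split: if_splits)

text \<open>
  The exponent is the one for which $m^\varphi |a_m|^p$ becomes $1/m$, the borderline of
  summability.
\<close>

lemma seq_norm_truncated_power:
  assumes "p \<noteq> 0"
  shows "seq_norm p \<phi> (truncated_power (- (\<phi> + 1) / p) N) = harm N powr (1 / p)"
proof -
  let ?a = "truncated_power (- (\<phi> + 1) / p) N"
  have "(\<Sum>k. real (Suc k) powr \<phi> * \<bar>?a (Suc k)\<bar> powr p)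
      = (\<Sum>k<N. real (Suc k) powr \<phi> * \<bar>?a (Suc k)\<bar> powr p)"
    by (intro suminf_finite) (auto simp: truncated_power_def)
  also have "\<dots> = (\<Sum>k<N. inverse (real (Suc k)))"
  proof (rule sum.cong)
    fix k assume "k \<in> {..<N}"
    then have "real (Suc k) powr \<phi> * \<bar>?a (Suc k)\<bar> powr p
        = real (Suc k) powr (\<phi> + - (\<phi> + 1) / p * p)"
      unfolding powr_add by (simp add: truncated_power_def powr_powr)
    also have "\<phi> + - (\<phi> + 1) / p * p = - 1"
      using assms by simp
    finally show "real (Suc k) powr \<phi> * \<bar>?a (Suc k)\<bar> powr p = inverse (real (Suc k))"
      by (simp add: powr_minus)
  qed simp
  also have "\<dots> = harm N"
    by (simp add: harm_altdef)
  finally show ?thesis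
    by (simp add: seq_norm_def)
qed

lemma H_op_truncated_power:
  "H_op lam \<alpha> \<beta> (truncated_power c N) x
     = (\<Sum>m = 1..N. real m powr (\<alpha> + c) * x powr \<beta> / max (real m) x powr lam)"
proof -
  have "H_op lam \<alpha> \<beta> (truncated_power c N) x
      = (\<Sum>k<N. H_term lam \<alpha> \<beta> (truncated_power c N) x (Suc k))"
    unfolding H_op_def by (intro suminf_finite) (auto simp: H_term_def truncated_power_def)
  also have "\<dots> = (\<Sum>k<N. real (Suc k) powr (\<alpha> + c) * x powr \<beta> / max (real (Suc k)) x powr lam)"
    by (intro sum.cong) (auto simp: H_term_def truncated_power_def powr_add)
  also have "\<dots> = (\<Sum>m = 1..N. real m powr (\<alpha> + c) * x powr \<beta> / max (real m) x powr lam)"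
    by (rule sum.reindex_bij_witness[of _ "\<lambda>m. m - 1" Suc]) auto
  finally show ?thesis .
qed

text \<open>
  The terms with $m \leq x$ suffice. There the kernel is $x^{\beta-\lambda}$, independent of $m$,
  and a sum of powers remains.
\<close>

lemma H_op_truncated_power_lower_bound:
  fixes x :: real
  assumes x: "1 \<le> x" "x \<le> real N"
  shows "(1 / 2) powr \<bar>\<alpha> + c\<bar> / 4 * x powr (\<alpha> + c + 1 + \<beta> - lam)
    \<le> H_op lam \<alpha> \<beta> (truncated_power c N) x"
proof -
  have floor: "nat \<lfloor>x\<rfloor> \<le> N"
    using x by (simp add: floor_le_iff nat_le_iff)
  have max_eq: "max (real m) x = x" if "m \<le> nat \<lfloor>x\<rfloor>" for m
    using that x by (simp add: le_nat_floor max_def) linarith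
  have "(1 / 2) powr \<bar>\<alpha> + c\<bar> / 4 * x powr (\<alpha> + c + 1 + \<beta> - lam)
      = (1 / 2) powr \<bar>\<alpha> + c\<bar> / 4 * x powr (\<alpha> + c + 1) * (x powr \<beta> / x powr lam)"
    by (simp add: powr_add powr_diff)
  also have "\<dots> \<le> (\<Sum>m = 1..nat \<lfloor>x\<rfloor>. real m powr (\<alpha> + c)) * (x powr \<beta> / x powr lam)"
    using x by (intro mult_right_mono sum_powr_lower_bound) auto
  also have "\<dots> = (\<Sum>m = 1..nat \<lfloor>x\<rfloor>. real m powr (\<alpha> + c) * x powr \<beta> / max (real m) x powr lam)"
    unfolding sum_distrib_right by (intro sum.cong) (auto simp: max_eq)
  also have "\<dots> \<le> (\<Sum>m = 1..N. real m powr (\<alpha> + c) * x powr \<beta> / max (real m) x powr lam)"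
    using floor by (intro sum_mono2) auto
  finally show ?thesis
    by (simp add: H_op_truncated_power)
qed

section \<open>Necessity of the two conditions\<close>

text \<open>
  With \<open>N = 1\<close> the truncated power is the first unit sequence, whatever its exponent, and its
  image is $x^\beta$ on $(0,1]$.
\<close>

lemma H_bounded_imp_weight_condition:
  fixes p q lam \<alpha> \<beta> \<phi> \<psi> :: real
  assumes "H_bounded lam \<alpha> \<beta> p \<phi> q \<psi>"
  shows "- q * \<beta> < \<psi> + 1"
proof (rule ccontr)
  assume "\<not> - q * \<beta> < \<psi> + 1"
  then have exponent: "\<beta> * q + \<psi> \<le> - 1"
    by (simp add: algebra_simps)
  let ?f = "\<lambda>x. \<bar>H_op lam \<alpha> \<beta> (truncated_power 0 1) x\<bar> powr q * x powr \<psi>"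
  define I where "I = integral\<^sup>L (lebesgue_on {0<..}) ?f"
  have int: "integrable (lebesgue_on {0<..}) ?f"
    using assms truncated_power_in_seq_space[of 0 1 p \<phi>]
    by (auto simp: H_bounded_def fun_space_def)
  (* The integral of 1/x from this lower endpoint to 1 is \<bar>I\<bar> + 1, more than I. *)
  have le: "1 / x \<le> ?f x" if "x \<in> {exp (- (\<bar>I\<bar> + 1))..1}" for x
  proof -
    have x: "0 < x" "x \<le> 1"
      using that by (auto intro: less_le_trans[OF exp_gt_zero])
    have "1 / x = x powr (- 1)"
      using x by (simp add: powr_minus_divide)
    also have "\<dots> \<le> x powr (\<beta> * q + \<psi>)"
      using x exponent by (intro powr_mono') auto
    also have "\<dots> = ?f x"
      using x by (simp add: H_op_truncated_power powr_powr powr_add)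
    finally show ?thesis .
  qed
  have "1 * ln (1 / exp (- (\<bar>I\<bar> + 1))) \<le> integral\<^sup>L (lebesgue_on {0<..}) ?f"
  proof (rule ln_le_integral[OF int])
    show "1 / x \<le> ?f x" if "x \<in> {exp (- (\<bar>I\<bar> + 1))..1}" for x
      using le that .
  qed auto
  then show False
    using I_def by (simp add: ln_div)
qed

text \<open>
  If the condition failed, testing on the truncated powers would give
  $b (\ln N)^{1/q} \leq |C| (1 + \ln N)^{1/p}$ for all $N \geq 1$ with a fixed $b > 0$, which is
  impossible for large $N$ since $1/q > 1/p$.
\<close>

lemma H_bounded_imp_exponent_condition:
  fixes p q lam \<alpha> \<beta> \<phi> \<psi> :: real
  assumes q: "0 < q" and qp: "q < p" and bounded: "H_bounded lam \<alpha> \<beta> p \<phi> q \<psi>"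
  shows "\<alpha> + \<beta> + 1 + (\<psi> + 1) / q - (\<phi> + 1) / p < lam"
proof (rule ccontr)
  assume "\<not> \<alpha> + \<beta> + 1 + (\<psi> + 1) / q - (\<phi> + 1) / p < lam"
  define c where "c = - (\<phi> + 1) / p"
  define b where "b = (1 / 2) powr \<bar>\<alpha> + c\<bar> / (4::real)"
  have b: "0 < b"
    by (simp add: b_def)
  have "lam \<le> \<alpha> + c + 1 + \<beta> + (\<psi> + 1) / q"
    using \<open>\<not> _\<close> by (simp add: c_def add_divide_distrib diff_divide_distrib)
  then have "- 1 / q \<le> \<alpha> + c + 1 + \<beta> - lam + \<psi> / q"
    by (simp add: add_divide_distrib)
  then have exponent: "- 1 \<le> (\<alpha> + c + 1 + \<beta> - lam) * q + \<psi>"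
    using q by (simp add: field_simps)
  obtain C where C: "\<And>a. a \<in> seq_space p \<phi> \<Longrightarrow> H_op lam \<alpha> \<beta> a \<in> fun_space q \<psi> \<and>
      fun_norm q \<psi> (H_op lam \<alpha> \<beta> a) \<le> C * seq_norm p \<phi> a"
    using bounded by (auto simp: H_bounded_def)
  have growth: "b * ln (real N) powr (1 / q) \<le> \<bar>C\<bar> * (ln (real N) + 1) powr (1 / p)" if N: "1 \<le> N" for N
  proof -
    define a where "a = truncated_power c N"
    let ?f = "\<lambda>x. \<bar>H_op lam \<alpha> \<beta> a x\<bar> powr q * x powr \<psi>"
    have a: "a \<in> seq_space p \<phi>"
      unfolding a_def by (rule truncated_power_in_seq_space)
    have int: "integrable (lebesgue_on {0<..}) ?f"
      using C[OF a] by (simp add: fun_space_def)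
    have le: "b powr q / x \<le> ?f x" if "x \<in> {1..real N}" for x
    proof -
      have x: "1 \<le> x" "x \<le> real N"
        using that by auto
      have "b powr q / x = b powr q * x powr (- 1)"
        using x by (simp add: powr_minus_divide)
      also have "\<dots> \<le> b powr q * x powr ((\<alpha> + c + 1 + \<beta> - lam) * q + \<psi>)"
        using x exponent by (intro mult_left_mono powr_mono) auto
      also have "\<dots> = (b * x powr (\<alpha> + c + 1 + \<beta> - lam)) powr q * x powr \<psi>"
        using b by (simp add: powr_mult powr_powr powr_add)
      also have "\<dots> \<le> ?f x"
        using H_op_truncated_power_lower_bound[OF x, of \<alpha> c \<beta> lam] b q
        by (intro mult_right_mono powr_mono2) (auto simp: b_def a_def)
      finally show ?thesis .
    qed
    have "b powr q * ln (real N / 1) \<le> integral\<^sup>L (lebesgue_on {0<..}) ?f"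
      by (rule ln_le_integral[OF int]) (use le N in auto)
    then have "(b powr q * ln (real N)) powr (1 / q) \<le> fun_norm q \<psi> (H_op lam \<alpha> \<beta> a)"
      unfolding fun_norm_def using q N by (intro powr_mono2) auto
    moreover have "(b powr q * ln (real N)) powr (1 / q) = b * ln (real N) powr (1 / q)"
      using b q N by (simp add: powr_mult powr_powr)
    moreover have "fun_norm q \<psi> (H_op lam \<alpha> \<beta> a) \<le> \<bar>C\<bar> * seq_norm p \<phi> a"
      using C[OF a] mult_right_mono[of C "\<bar>C\<bar>" "seq_norm p \<phi> a"]
      by (auto simp: seq_norm_def intro: order_trans)
    moreover have "seq_norm p \<phi> a \<le> (ln (real N) + 1) powr (1 / p)"
    proof -
      have "harm N - ln (real N) \<le> (1::real)"
        using euler_mascheroni_sequence_decreasing[of 1 N] N by (simp add: harm_expand)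
      then show ?thesis
        unfolding a_def c_def using q qp
        by (subst seq_norm_truncated_power) (auto intro!: powr_mono2 harm_nonneg)
    qed
    then have "\<bar>C\<bar> * seq_norm p \<phi> a \<le> \<bar>C\<bar> * (ln (real N) + 1) powr (1 / p)"
      by (rule mult_left_mono) simp
    ultimately show ?thesis
      by linarith
  qed
  (* For L = ln N \<ge> 1 the growth bound yields L powr \<delta> \<le> D with D independent of N;
     y is chosen so that L \<ge> y violates this. *)
  define \<delta> where "\<delta> = 1 / q - 1 / p"
  have \<delta>: "0 < \<delta>"
    using q qp by (simp add: \<delta>_def field_simps)
  define D where "D = \<bar>C\<bar> * 2 powr (1 / p) / b"
  have D: "0 \<le> D"
    using b by (simp add: D_def)
  define y where "y = max 1 ((D + 1) powr (1 / \<delta>))"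
  obtain N :: nat where N: "exp y \<le> real N"
    using real_arch_simple by blast
  then have "0 < real N"
    using exp_gt_zero[of y] by linarith
  then have lnN: "y \<le> ln (real N)" "1 \<le> N"
    using N by (auto simp: ln_ge_iff)
  define L where "L = ln (real N)"
  have L: "1 \<le> L" "(D + 1) powr (1 / \<delta>) \<le> L"
    using lnN by (auto simp: L_def y_def)
  have "D + 1 = ((D + 1) powr (1 / \<delta>)) powr \<delta>"
    using \<delta> D by (simp add: powr_powr)
  also have "\<dots> \<le> L powr \<delta>"
    using L \<delta> by (intro powr_mono2) auto
  finally have large: "D + 1 \<le> L powr \<delta>" .
  have "b * (L powr \<delta> * L powr (1 / p)) = b * L powr (1 / q)"
    by (simp add: \<delta>_def flip: powr_add)
  also have "\<dots> \<le> \<bar>C\<bar> * (L + 1) powr (1 / p)"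
    using growth[OF lnN(2)] by (simp add: L_def)
  also have "\<dots> \<le> \<bar>C\<bar> * (2 * L) powr (1 / p)"
    using L q qp by (intro mult_left_mono powr_mono2) auto
  also have "\<dots> = b * (D * L powr (1 / p))"
    using b L by (simp add: D_def powr_mult)
  finally have "L powr \<delta> \<le> D"
    using b L by simp
  with large show False
    by simp
qed

theorem theorem1p8:
  fixes p q lam \<alpha> \<beta> \<phi> \<psi> :: real
  assumes "1 < q" and "q < p"
    and "\<phi> + 1 < p * (\<alpha> + 1)"
  shows "H_bounded lam \<alpha> \<beta> p \<phi> q \<psi> \<longleftrightarrow>
    lam > \<alpha> + \<beta> + 1 + (\<psi> + 1) / q - (\<phi> + 1) / p \<and> - q * \<beta> < \<psi> + 1"
  using assms H_boundedI[of p q \<phi> \<alpha> \<beta> \<psi> lam]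
    H_bounded_imp_exponent_condition[of q p lam \<alpha> \<beta> \<phi> \<psi>]
    H_bounded_imp_weight_condition[of lam \<alpha> \<beta> p \<phi> q \<psi>]
  by auto

end
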